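(* Let $X$ be a real Banach space that is smooth and uniformly convex and whose duality mapping $J_p:X\to X^*$ is sequentially weak-to-weak continuous, let $Y$ be an arbitrary real Banach space, let $A:X\to Y$ be bounded linear, let $y\in\mathcal{R}(A)$ and $M=\{x\in X: Ax=y\}$. Run the SESOP method with semi-orthogonalized truncated search spaces described in the context. Then either the method stops after finitely many steps $n$ (i.e. $R_n=\|Ax_n-y\|_Y=0$), in which case $x_n$ equals the Bregman projection $\Pi_M(x_0)$ of $x_0$ onto $M$, or the sequence of iterates $(x_n)_n$ converges weakly to $\Pi_M(x_0)$.
   Context: Fix $p,r\in(1,\infty)$ and $p^*=p/(p-1)$. $J_p:X\to X^*$ is the (single-valued, since $X$ is smooth) duality mapping with gauge $t\mapsto t^{p-1}$: $J_p(x)$ is the element $x^*$ with $\langle x^*,x\rangle=\|x\|^p$ and $\|x^*\|=\|x\|^{p-1}$; equivalently $J_p$ is the derivative of $\tfrac1p\|\cdot\|^p$. $J_{p^*}:X^*\to X$ is the duality mapping of $X^*$ with gauge $t^{p^*-1}$ (the inverse of $J_p$). $J_r^Y:Y\to Y^*$ is a fixed single-valued selection of the duality mapping of $Y$ with gauge $t^{r-1}$, so $\langle J_r^Y(w),w\rangle=\|w\|^r$, $\|J_r^Y(w)\|=\|w\|^{r-1}$. The Bregman distance is $D_p(x,z)=\tfrac1{p^*}\|x\|^p-\langle J_p(x),z\rangle+\tfrac1p\|z\|^p$, and the Bregman projection $\Pi_C(x)$ of $x$ onto a closed convex nonempty $C\subset X$ is the unique minimizer of $z\mapsto D_p(x,z)$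 over $z\in C$. $A^*:Y^*\to X^*$ is the adjoint. Method: choose $x_0$ with $J_p(x_0)\in\overline{\mathcal{R}(A^* )}$, fix $N\in\mathbb{N}$, and set $N_n=\min(N,n+1)$. For $n=0,1,\dots$: let $w_n=Ax_n-y$, $R_n=\|w_n\|$; if $R_n=0$, stop. Otherwise let $u_n^*=J_r^Y(w_n)\in Y^*$ and $u_n=A^*u_n^*$ (Landweber descent direction). Let $s_n=(s_{n,1},\dots,s_{n,N_{n-1}})$ minimize $s\mapsto\|u_n-\sum_{i=1}^{N_{n-1}}s_iv_{n-1,i}\|_{X^*}^{p^*}$ (for $n=0$ the sum is empty). Define the new direction $v_{n,N_n}=u_n-\sum_{k=1}^{N_{n-1}}s_{n,k}v_{n-1,k}$ with precursor $w^*_{n,N_n}=u_n^*-\sum_k s_{n,k}w^*_{n-1,k}$ (so $v_{n,N_n}=A^*w^*_{n,N_n}$); the remaining directions $v_{n,1},\dots,v_{n,N_n-1}$ (and their precursors) are the last $N_n-1$ entries of the previous list $v_{n-1,1},\dots,v_{n-1,N_{n-1}}$, kept in order. Set offsets $\beta_{n,k}=\langle w^*_{n,k},y\rangle$ and $V_n=\mathrm{span}\{v_{n,1},\dots,v_{n,N_n}\}$. Let $t_n$ minimize $h_n(t)=\tfrac1{p^*}\|J_p(x_n)-\sum_{k=1}^{N_n}t_kv_{n,k}\|_{X^*}^{p^*}+\sum_{k=1}^{N_n}t_k\beta_{n,k}$ over $t\in\mathbb{R}^{N_n}$ and set $x_{n+1}=J_{p^*}\big(J_p(x_n)-\sum_{k=1}^{N_n}t_{n,k}v_{n,k}\big)$.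 *)

theory Defs
  imports "HOL-Analysis.Analysis"
begin

definition smooth_space :: "('a::real_normed_vector) itself \<Rightarrow> bool" where
  "smooth_space _ \<longleftrightarrow>
     (\<forall>x::'a. x \<noteq> 0 \<longrightarrow> (\<exists>!f::'a \<Rightarrow>\<^sub>L real. norm f = 1 \<and> blinfun_apply f x = norm x))"

definition uniformly_convex_space :: "('a::real_normed_vector) itself \<Rightarrow> bool" where
  "uniformly_convex_space _ \<longleftrightarrow>
     (\<forall>e. 0 < e \<and> e \<le> 2 \<longrightarrow> (\<exists>d>0. \<forall>x z::'a. norm x \<le> 1 \<longrightarrow> norm z \<le> 1 \<longrightarrow>
        norm (x - z) \<ge> e \<longrightarrow> norm ((1/2) *\<^sub>R (x + z)) \<le> 1 - d))"

definition weak_conv :: "(nat \<Rightarrow> 'a::real_normed_vector) \<Rightarrow> 'a \<Rightarrow> bool" where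
  "weak_conv xs x \<longleftrightarrow> (\<forall>f::'a \<Rightarrow>\<^sub>L real. (\<lambda>n. blinfun_apply f (xs n)) \<longlonglongrightarrow> blinfun_apply f x)"

text \<open>Duality mapping J_p with gauge t^(p-1) (single valued in smooth spaces).\<close>
definition dual_map :: "real \<Rightarrow> 'a::real_normed_vector \<Rightarrow> ('a \<Rightarrow>\<^sub>L real)" where
  "dual_map p x = (THE f. blinfun_apply f x = norm x powr p \<and> norm f = norm x powr (p - 1))"

text \<open>J_q of the dual space with gauge t^(q-1), with the bidual identified with the
  space via the canonical embedding (used with q = p*, it is the inverse of J_p).\<close>
definition dual_map_dual :: "real \<Rightarrow> ('a::real_normed_vector \<Rightarrow>\<^sub>L real) \<Rightarrow> 'a" where
  "dual_map_dual q f = (THE x. blinfun_apply f x = norm f powr q \<and> norm x = norm f powr (q - 1))"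

definition bregman_dist :: "real \<Rightarrow> 'a::real_normed_vector \<Rightarrow> 'a \<Rightarrow> real" where
  "bregman_dist p x z = norm x powr p / (p / (p - 1)) - blinfun_apply (dual_map p x) z + norm z powr p / p"

definition bregman_proj :: "real \<Rightarrow> 'a::real_normed_vector set \<Rightarrow> 'a \<Rightarrow> 'a" where
  "bregman_proj p C x = (THE z. z \<in> C \<and> (\<forall>z'\<in>C. bregman_dist p x z \<le> bregman_dist p x z'))"

end

theory Submission
  imports Defs "HOL-Library.Diagonal_Subsequence"
begin

text \<open>Minimality of \<open>t\<^sub>n\<close> says that \<open>x\<^sub>n\<^sub>+\<^sub>1\<close> lies on every hyperplane
  \<open>\<langle>v\<^sub>n\<^sub>,\<^sub>k, \<cdot>\<rangle> = \<beta>\<^sub>n\<^sub>,\<^sub>k\<close>; these contain the solution set \<open>M\<close>, so for \<open>z \<in> M\<close> the three-point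
  identity becomes \<open>D(x\<^sub>n, z) = D(x\<^sub>n, x\<^sub>n\<^sub>+\<^sub>1) + D(x\<^sub>n\<^sub>+\<^sub>1, z)\<close>. Hence the iterates are bounded and
  \<open>D(x\<^sub>n, x\<^sub>n\<^sub>+\<^sub>1) \<rightarrow> 0\<close>, which by uniform convexity forces \<open>x\<^sub>n - x\<^sub>n\<^sub>+\<^sub>1 \<rightarrow> 0\<close>. The new direction
  pairs with \<open>x\<^sub>n - x\<^sub>n\<^sub>+\<^sub>1\<close> to \<open>R\<^sub>n\<^sup>r\<close> and its norm is at most \<open>\<parallel>A\<parallel> R\<^sub>n\<^sup>r\<^sup>-\<^sup>1\<close>, so
  \<open>R\<^sub>n \<le> \<parallel>A\<parallel> \<parallel>x\<^sub>n - x\<^sub>n\<^sub>+\<^sub>1\<parallel> \<rightarrow> 0\<close>. All \<open>J x\<^sub>n - J x\<^sub>0\<close> annihilate the kernel of \<open>A\<close>; by weak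
  continuity of \<open>J\<close> so does \<open>J c - J x\<^sub>0\<close> for every weak cluster point \<open>c\<close>, and \<open>c \<in> M\<close>. These two
  properties characterise the Bregman projection, so it is the only weak cluster point.\<close>

section \<open>Weak sequential compactness in uniformly convex spaces\<close>

text \<open>Moves uniform convexity from the unit ball to a sphere of any radius, with slack
  \<open>d\<close>, so that it applies to vectors whose norms merely converge to \<alpha>. Division
  by \<open>\<alpha> + d\<close> lands in the unit ball.\<close>

lemma uniformly_convex_near_sphere:
  fixes \<alpha> e :: real
  assumes uc: "uniformly_convex_space TYPE('a::real_normed_vector)" and "0 \<le> \<alpha>" "0 < e"
  obtains d where "0 < d" "\<And>a b::'a. norm a \<le> \<alpha> + d \<Longrightarrow> norm b \<le> \<alpha> + d \<Longrightarrow>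
           \<alpha> - d \<le> norm ((1/2) *\<^sub>R (a + b)) \<Longrightarrow> norm (a - b) < e"
proof (cases "\<alpha> = 0")
  case True
  have "norm (a - b) < e" if "norm a \<le> \<alpha> + e/3" "norm b \<le> \<alpha> + e/3" for a b :: 'a
    using norm_triangle_ineq4[of a b] that True \<open>0 < e\<close> by simp
  with \<open>0 < e\<close> show ?thesis by (intro that[of "e/3"]) auto
next
  case False
  with assms have \<alpha>: "0 < \<alpha>" by simp
  \<comment> \<open>Scaling by \<open>1 / (\<alpha> + d)\<close> with
    \<open>d \<le> \<alpha>\<close> leaves a distance of at least \<open>e / (2*\<alpha>)\<close>;
    the cap 2 meets the range allowed in \<open>uniformly_convex_space\<close>.\<close>
  define e' where "e' = min 2 (e / (2*\<alpha>))"
  have "0 < e'" "e' \<le> 2" using \<alpha> \<open>0 < e\<close> by (auto simp: e'_def)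
  then obtain \<delta> where "0 < \<delta>" and \<delta>: "\<And>x z::'a. norm x \<le> 1 \<Longrightarrow> norm z \<le> 1 \<Longrightarrow>
        e' \<le> norm (x - z) \<Longrightarrow> norm ((1/2) *\<^sub>R (x + z)) \<le> 1 - \<delta>"
    using uc unfolding uniformly_convex_space_def by blast
  \<comment> \<open>If the scaled midpoint had norm at most \<open>1 - \<delta>\<close>, then
    \<open>(\<alpha> + d) * \<delta> \<le> 2 * d\<close>, which the bound
    \<open>\<alpha> * \<delta> / 3\<close> excludes.\<close>
  define d where "d = min \<alpha> (\<alpha> * \<delta> / 3)"
  have d: "0 < d" "d \<le> \<alpha>" "d \<le> \<alpha> * \<delta> / 3" using \<alpha> \<open>0 < \<delta>\<close> by (auto simp: d_def)
  have "norm (a - b) < e"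
    if ab: "norm a \<le> \<alpha> + d" "norm b \<le> \<alpha> + d" "\<alpha> - d \<le> norm ((1/2) *\<^sub>R (a + b))" for a b :: 'a
  proof (rule ccontr)
    define c where "c = inverse (\<alpha> + d)"
    have c: "0 < c" "c * (\<alpha> + d) = 1" using \<alpha> d by (auto simp: c_def)
    assume "\<not> norm (a - b) < e"
    moreover have "e / (2*\<alpha>) \<le> c * e"
      using \<alpha> d \<open>0 < e\<close> by (simp add: c_def field_simps)
    ultimately have "e' \<le> c * norm (a - b)"
      using c by (smt (verit, ccfv_SIG) e'_def mult_left_mono)
    then have "e' \<le> norm (c *\<^sub>R a - c *\<^sub>R b)"
      using c by (simp flip: scaleR_diff_right)
    moreover have "norm (c *\<^sub>R a) \<le> 1" "norm (c *\<^sub>R b) \<le> 1"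
      using ab c by (auto simp: c_def field_simps)
    ultimately have "norm ((1/2) *\<^sub>R (c *\<^sub>R a + c *\<^sub>R b)) \<le> 1 - \<delta>"
      by (intro \<delta>)
    moreover have "(1/2) *\<^sub>R (c *\<^sub>R a + c *\<^sub>R b) = c *\<^sub>R ((1/2) *\<^sub>R (a + b))"
      by (simp add: algebra_simps)
    ultimately have "norm (c *\<^sub>R ((1/2) *\<^sub>R (a + b))) \<le> 1 - \<delta>" by (simp only:)
    then have "c * norm ((1/2) *\<^sub>R (a + b)) \<le> 1 - \<delta>"
      using c by (simp only: norm_scaleR[of c] abs_of_pos)
    then have "c * (\<alpha> - d) \<le> c * ((\<alpha> + d) * (1 - \<delta>))"
      using mult_left_mono[OF ab(3) less_imp_le[OF c(1)]] c(2)
      by (simp only: mult.assoc[symmetric] mult_1)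
    then have "\<alpha> - d \<le> (\<alpha> + d) * (1 - \<delta>)" using c by simp
    moreover have "0 < d * \<delta>" "0 < \<alpha> * \<delta>" using d \<alpha> \<open>0 < \<delta>\<close> by auto
    ultimately show False using d by (simp add: algebra_simps)
  qed
  with d show ?thesis by (intro that) auto
qed

text \<open>Common core of norm attainment and of the intersection lemma below. The midpoint bound
  \<open>\<beta> m\<close> is uniform in all later \<open>n\<close> and has the same limit as the
  norms, so pairs far out meet the near-sphere criterion.\<close>

lemma uniformly_convex_CauchyI:
  fixes a :: "nat \<Rightarrow> 'a::real_normed_vector"
  assumes uc: "uniformly_convex_space TYPE('a)"
    and lim: "(\<lambda>n. norm (a n)) \<longlonglongrightarrow> \<alpha>"
    and mid: "\<And>m n. m \<le> n \<Longrightarrow> \<beta> m \<le> norm ((1/2) *\<^sub>R (a m + a n))"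
    and \<beta>: "\<beta> \<longlonglongrightarrow> \<alpha>"
  shows "Cauchy a"
proof (rule metric_CauchyI)
  fix e :: real assume "0 < e"
  have "0 \<le> \<alpha>" using lim by (rule LIMSEQ_le_const) auto
  from uniformly_convex_near_sphere[OF uc this \<open>0 < e\<close>] obtain d where "0 < d" and
    d: "\<And>a b::'a. norm a \<le> \<alpha> + d \<Longrightarrow> norm b \<le> \<alpha> + d \<Longrightarrow>
           \<alpha> - d \<le> norm ((1/2) *\<^sub>R (a + b)) \<Longrightarrow> norm (a - b) < e" by blast
  have "\<forall>\<^sub>F n in sequentially. norm (a n) < \<alpha> + d \<and> \<alpha> - d < \<beta> n"
    using order_tendstoD[OF lim] order_tendstoD[OF \<beta>] \<open>0 < d\<close> by (auto intro: eventually_conj)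
  then obtain M where M: "\<And>n. M \<le> n \<Longrightarrow> norm (a n) < \<alpha> + d" "\<And>n. M \<le> n \<Longrightarrow> \<alpha> - d < \<beta> n"
    unfolding eventually_sequentially by blast
  have *: "dist (a m) (a n) < e" if "M \<le> m" "m \<le> n" for m n
    unfolding dist_norm using M[of m] M[of n] mid[OF \<open>m \<le> n\<close>] that by (intro d) auto
  have "dist (a m) (a n) < e" if "M \<le> m" "M \<le> n" for m n
    using *[of m n] *[of n m] that by (metis dist_commute le_cases)
  then show "\<exists>M. \<forall>m\<ge>M. \<forall>n\<ge>M. dist (a m) (a n) < e" by blast
qed

text \<open>Near-maximizers in the unit ball form a Cauchy sequence: by linearity their midpoints
  are near-maximizers too and hence cannot be short. This later yields the existence of
  \<open>J' f\<close>.\<close>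

lemma norm_attained:
  fixes f :: "'a::banach \<Rightarrow>\<^sub>L real"
  assumes uc: "uniformly_convex_space TYPE('a)"
  obtains x where "norm x \<le> 1" "blinfun_apply f x = norm f"
proof (cases "f = 0")
  case True
  then show ?thesis by (intro that[of 0]) auto
next
  case False
  have "\<exists>x. norm x \<le> 1 \<and> norm f - norm f / real (Suc n) \<le> blinfun_apply f x" for n
  proof -
    define b where "b = norm f - norm f / real (Suc n)"
    have b: "0 \<le> b" "b < norm f" using False by (auto simp: b_def field_simps)
    then obtain x where x: "b * norm x < norm (blinfun_apply f x)"
      by (meson leD norm_blinfun_bound not_le)
    with b have "x \<noteq> 0" by auto
    \<comment> \<open>The factor normalises the length and turns the value of \<open>f\<close> into
      its absolute value.\<close>
    define x' where "x' = (sgn (blinfun_apply f x) / norm x) *\<^sub>R x"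
    have "norm x' \<le> 1" by (simp add: x'_def abs_sgn_eq)
    moreover have "blinfun_apply f x' = \<bar>blinfun_apply f x\<bar> / norm x"
      by (simp add: x'_def blinfun.scaleR_right mult.commute abs_sgn)
    with x \<open>x \<noteq> 0\<close> have "b \<le> blinfun_apply f x'" by (simp add: pos_le_divide_eq)
    ultimately show ?thesis unfolding b_def by blast
  qed
  then obtain a where a: "\<And>n. norm (a n) \<le> 1"
      "\<And>n. norm f - norm f / real (Suc n) \<le> blinfun_apply f (a n)" by metis
  define \<beta> where "\<beta> n = 1 - 1 / real (Suc n)" for n
  have \<beta>: "\<beta> \<longlonglongrightarrow> 1"
    unfolding \<beta>_def using tendsto_diff[OF tendsto_const[of "1::real"] LIMSEQ_inverse_real_of_nat]
    by (simp add: inverse_eq_divide)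
  have fa: "norm f * \<beta> n \<le> blinfun_apply f (a n)" for n
    using a(2)[of n] by (simp add: \<beta>_def algebra_simps)
  have le: "\<beta> n \<le> norm z" if "norm f * \<beta> n \<le> blinfun_apply f z" for n z
    using norm_blinfun[of f z] that False
    by (smt (verit, best) mult_le_cancel_left_pos real_norm_def zero_less_norm_iff)
  have "incseq \<beta>" by (auto simp: incseq_def \<beta>_def field_simps)
  have "(\<lambda>n. norm (a n)) \<longlonglongrightarrow> 1"
    using a(1) le[OF fa] by (intro tendsto_sandwich[OF _ _ \<beta> tendsto_const]) auto
  moreover have "\<beta> m \<le> norm ((1/2) *\<^sub>R (a m + a n))" if "m \<le> n" for m n
  proof (rule le)
    have "norm f * \<beta> m \<le> norm f * \<beta> n"
      using \<open>incseq \<beta>\<close> that by (intro mult_left_mono) (auto simp: incseq_def)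
    then show "norm f * \<beta> m \<le> blinfun_apply f ((1/2) *\<^sub>R (a m + a n))"
      using fa[of m] fa[of n] by (simp add: blinfun.bilinear_simps)
  qed
  ultimately have "Cauchy a" using uniformly_convex_CauchyI[OF uc _ _ \<beta>] by blast
  then obtain x where x: "a \<longlonglongrightarrow> x" using Cauchy_convergent convergent_def by blast
  have "norm x \<le> 1" using tendsto_norm[OF x] a(1) by (intro LIMSEQ_le_const2) auto
  moreover have "norm f * 1 \<le> blinfun_apply f x"
    using fa by (intro LIMSEQ_le[OF tendsto_mult[OF tendsto_const \<beta>] blinfun.tendsto[OF tendsto_const x]]) auto
  moreover have "blinfun_apply f x \<le> norm f * norm x"
    using norm_blinfun[of f x] by simp
  moreover have "norm f * norm x \<le> norm f"
    using \<open>norm x \<le> 1\<close> by (simp add: mult_left_le)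
  ultimately show ?thesis by (intro that[of x]) auto
qed

text \<open>Points of almost minimal norm are Cauchy: for \<open>m \<le> n\<close> convexity keeps
  the midpoint of \<open>a m\<close> and \<open>a n\<close> in \<open>C m\<close>, so its norm is at
  least the distance from 0 to \<open>C m\<close>, and these distances increase to a finite limit.
  This is the compactness input for weak limits.\<close>

lemma decseq_closed_convex_nonempty_Inter:
  fixes C :: "nat \<Rightarrow> 'a::banach set"
  assumes uc: "uniformly_convex_space TYPE('a)" and "decseq C"
    and cl: "\<And>n. closed (C n)" and cv: "\<And>n. convex (C n)" and ne: "\<And>n. C n \<noteq> {}"
    and bd: "bounded (C 0)"
  shows "(\<Inter>n. C n) \<noteq> {}"
proof -
  define \<beta> where "\<beta> n = infdist 0 (C n)" for n
  have sub: "C n \<subseteq> C m" if "m \<le> n" for m n using \<open>decseq C\<close> that by (auto simp: decseq_def)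
  have \<beta>_le: "\<beta> n \<le> norm z" if "z \<in> C n" for n z
    using infdist_le[OF that, of 0] by (simp add: \<beta>_def)
  obtain B where B: "\<And>z. z \<in> C 0 \<Longrightarrow> norm z \<le> B" using bd by (auto simp: bounded_iff)
  have "incseq \<beta>"
    unfolding incseq_def \<beta>_def by (auto intro!: infdist_mono sub ne)
  moreover have "\<beta> n \<le> B" for n
    using \<beta>_le B sub[of 0 n] ne[of n] by (meson all_not_in_conv le0 order_trans subsetD)
  ultimately obtain \<alpha> where \<beta>: "\<beta> \<longlonglongrightarrow> \<alpha>" using incseq_convergent by blast
  have "\<exists>z \<in> C n. norm z < \<beta> n + 1 / real (Suc n)" for n
  proof (rule ccontr)
    assume "\<not> ?thesis"
    then have "\<beta> n + 1 / real (Suc n) \<le> infdist 0 (C n)"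
      using ne[of n] by (auto simp: infdist_def not_less intro!: cINF_greatest)
    then show False by (simp add: \<beta>_def)
  qed
  then obtain a where a: "\<And>n. a n \<in> C n" "\<And>n. norm (a n) < \<beta> n + 1 / real (Suc n)" by metis
  have "(\<lambda>n. \<beta> n + 1 / real (Suc n)) \<longlonglongrightarrow> \<alpha>"
    using tendsto_add[OF \<beta> LIMSEQ_inverse_real_of_nat] by (simp add: inverse_eq_divide)
  then have "(\<lambda>n. norm (a n)) \<longlonglongrightarrow> \<alpha>"
    using \<beta>_le[OF a(1)] less_imp_le[OF a(2)]
    by (auto intro!: always_eventually tendsto_sandwich[where f=\<beta>, OF _ _ \<beta>,
        where h="\<lambda>n. \<beta> n + 1 / real (Suc n)"] simp del: of_nat_Suc)
  moreover have "\<beta> m \<le> norm ((1/2) *\<^sub>R (a m + a n))" if "m \<le> n" for m n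
  proof (rule \<beta>_le)
    have "a n \<in> C m" using sub[OF that] a(1) by blast
    then show "(1/2) *\<^sub>R (a m + a n) \<in> C m"
      using convexD[OF cv[of m] a(1)[of m], of "a n" "1/2" "1/2"] by (simp add: scaleR_add_right)
  qed
  ultimately have "Cauchy a" using uniformly_convex_CauchyI[OF uc _ _ \<beta>] by blast
  then obtain c where c: "a \<longlonglongrightarrow> c" using Cauchy_convergent convergent_def by blast
  have "c \<in> C m" for m
  proof (rule Lim_in_closed_set[OF cl _ _ c])
    show "\<forall>\<^sub>F n in sequentially. a n \<in> C m"
      using sub a(1) by (intro eventually_sequentiallyI[of m]) blast
  qed simp
  then show ?thesis by blast
qed

text \<open>For every \<open>e\<close>, the preimage of the ball of radius \<open>e\<close> about
  \<open>l\<close> is closed, convex and contains a tail of \<open>z\<close>; hence it contains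
  \<open>c\<close>.\<close>

lemma closure_convex_hull_tail_limit:
  fixes z :: "nat \<Rightarrow> 'a::real_normed_vector" and f :: "'a \<Rightarrow>\<^sub>L real"
  assumes c: "\<And>n. c \<in> closure (convex hull (z ` {n..}))"
    and l: "(\<lambda>n. blinfun_apply f (z n)) \<longlonglongrightarrow> l"
  shows "blinfun_apply f c = l"
proof -
  have "dist l (blinfun_apply f c) \<le> 0 + e" if "0 < e" for e
  proof -
    obtain n where n: "\<And>k. n \<le> k \<Longrightarrow> dist (blinfun_apply f (z k)) l < e"
      using l \<open>0 < e\<close> unfolding lim_sequentially by blast
    let ?S = "blinfun_apply f -` cball l e"
    have "closed ?S" by (intro closed_vimage continuous_intros) auto
    moreover have "convex ?S"
      by (intro convex_linear_vimage convex_cball) (simp add: blinfun.bounded_linear_right bounded_linear.linear)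
    moreover have "z ` {n..} \<subseteq> ?S" using n by (force simp: dist_commute)
    ultimately have "closure (convex hull (z ` {n..})) \<subseteq> ?S"
      by (intro closure_minimal hull_minimal)
    with c[of n] show ?thesis by auto
  qed
  then have "dist l (blinfun_apply f c) \<le> 0" by (rule field_le_epsilon)
  then show ?thesis by simp
qed

section \<open>Diagonal subsequences, separability and weak limits\<close>

lemma bounded_diagonal_subsequence:
  fixes g :: "nat \<Rightarrow> nat \<Rightarrow> real"
  assumes bd: "\<And>i. bounded (range (g i))"
  obtains s where "strict_mono (s :: nat \<Rightarrow> nat)" "\<And>i. convergent (\<lambda>k. g i (s k))"
proof -
  let ?P = "\<lambda>i s. convergent (\<lambda>k. g i (s k))"
  interpret subseqs ?P
  proof
    fix i and s :: "nat \<Rightarrow> nat"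
    have "bounded (range (g i \<circ> s))" using bd[of i] by (rule bounded_subset) auto
    then obtain l r where "strict_mono r" "((g i \<circ> s) \<circ> r) \<longlonglongrightarrow> l"
      using bounded_imp_convergent_subsequence by blast
    then show "\<exists>r. strict_mono r \<and> ?P i (s \<circ> r)" by (auto simp: convergent_def o_def)
  qed
  \<comment> \<open>The diagonal argument controls stage \<open>i\<close> only on the tail from
    \<open>Suc i\<close>; the shift is removed afterwards, as it does not affect
    convergence.\<close>
  have "?P i (diagseq \<circ> (+) (Suc i))" for i
  proof (rule diagseq_holds)
    fix r s i assume "strict_mono (r :: nat \<Rightarrow> nat)" "?P i s"
    then show "?P i (s \<circ> r)" using convergent_subseq_convergent by (fastforce simp: o_def)
  qed
  then have "convergent (\<lambda>k. g i (diagseq (k + Suc i)))" for i by (simp only: o_def add.commute)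
  then have "?P i diagseq" for i
    by (metis (no_types) LIMSEQ_offset[of "\<lambda>k. g i (diagseq k)" "Suc i"] convergent_def)
  then show ?thesis using subseq_diagseq that by blast
qed

lemma not_tendsto_subsequence:
  fixes x :: "nat \<Rightarrow> 'a::metric_space"
  assumes "\<not> x \<longlonglongrightarrow> l"
  shows "\<exists>(r :: nat \<Rightarrow> nat) e. strict_mono r \<and> 0 < e \<and> (\<forall>n. e \<le> dist (x (r n)) l)"
proof -
  obtain e where "0 < e" and e: "\<And>M. \<exists>n\<ge>M. e \<le> dist (x n) l"
    using assms unfolding lim_sequentially by (meson not_less)
  then have "infinite {n. e \<le> dist (x n) l}"
    unfolding infinite_nat_iff_unbounded_le by blast
  from infinite_enumerate[OF this] show ?thesis using \<open>0 < e\<close> by blast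
qed

text \<open>Rational combinations are built one vector at a time, so density follows by induction:
  split off the last coefficient and approximate it by a rational.\<close>

lemma span_range_separable:
  fixes x :: "nat \<Rightarrow> 'a::real_normed_vector"
  obtains D where "countable D" "span (range x) \<subseteq> closure D"
proof -
  define D where "D = rec_nat {0::'a} (\<lambda>m S. (\<lambda>(u, c). u + of_rat c *\<^sub>R x m) ` (S \<times> (UNIV :: rat set)))"
  have D0: "D 0 = {0}" and DSuc: "D (Suc m) = (\<lambda>(u, c). u + of_rat c *\<^sub>R x m) ` (D m \<times> UNIV)" for m
    by (simp_all add: D_def)
  have count: "countable (D m)" for m by (induction m) (auto simp: D0 DSuc)
  have dense: "span (x ` {..<m}) \<subseteq> closure (D m)" for m
  proof (induction m)
    case 0
    then show ?case by (simp add: D0)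
  next
    case (Suc m)
    show ?case
    proof
      fix u assume "u \<in> span (x ` {..<Suc m})"
      then have "u \<in> span (insert (x m) (x ` {..<m}))" by (simp add: lessThan_Suc)
      then obtain k where "u - k *\<^sub>R x m \<in> span (x ` {..<m})" using span_breakdown_eq by blast
      with Suc.IH have uk: "u - k *\<^sub>R x m \<in> closure (D m)" by blast
      show "u \<in> closure (D (Suc m))"
        unfolding closure_approachable
      proof (intro allI impI)
        fix e :: real assume "0 < e"
        then obtain u' where u': "u' \<in> D m" "dist u' (u - k *\<^sub>R x m) < e/2"
          using uk unfolding closure_approachable by (meson half_gt_zero)
        \<comment> \<open>The summand 1 keeps the tolerance positive when \<open>x m\<close>
          vanishes.\<close>
        have "0 < e / (2 * (norm (x m) + 1))" using \<open>0 < e\<close> by (simp add: add_nonneg_pos)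
        then obtain c :: rat where c: "k < of_rat c" "of_rat c < k + e / (2 * (norm (x m) + 1))"
          using of_rat_dense[of k "k + e / (2 * (norm (x m) + 1))"] by auto
        have "dist (u' + of_rat c *\<^sub>R x m) u \<le> dist u' (u - k *\<^sub>R x m) + norm ((of_rat c - k) *\<^sub>R x m)"
          unfolding dist_norm by (rule order_trans[OF _ norm_triangle_ineq]) (simp add: algebra_simps)
        also have "norm ((of_rat c - k) *\<^sub>R x m) \<le> e / (2 * (norm (x m) + 1)) * (norm (x m) + 1)"
          unfolding norm_scaleR using c by (intro mult_mono) auto
        also have "\<dots> = e / 2" using norm_ge_zero[of "x m"] by (simp add: divide_simps add_nonneg_eq_0_iff)
        finally have "dist (u' + of_rat c *\<^sub>R x m) u < e" using u' by simp
        moreover have "u' + of_rat c *\<^sub>R x m \<in> D (Suc m)" using u' by (force simp: DSuc)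
        ultimately show "\<exists>y\<in>D (Suc m). dist y u < e" by blast
      qed
    qed
  qed
  have "span (range x) \<subseteq> closure (\<Union>m. D m)"
  proof
    fix u assume "u \<in> span (range x)"
    then obtain T c where T: "finite T" "T \<subseteq> range x" and "u = (\<Sum>a\<in>T. c a *\<^sub>R a)"
      unfolding span_explicit by blast
    then have "u \<in> span T" by (simp add: span_sum span_scale span_base)
    then obtain I where "finite I" "T = x ` I" using T by (meson finite_subset_image)
    then obtain m where "T \<subseteq> x ` {..<m}" by (metis finite_nat_iff_bounded image_mono)
    then have "u \<in> closure (D m)" using \<open>u \<in> span T\<close> dense[of m] span_mono by blast
    then show "u \<in> closure (\<Union>m. D m)" using closure_mono[of "D m" "\<Union>m. D m"] by blast
  qed
  with count show ?thesis by (intro that) auto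
qed

text \<open>Norming functionals of a countable dense subset of the span separate its points. A diagonal
  subsequence converges against all of them; any point common to the closed convex hulls of its tails
  (one exists by uniform convexity, for every further subsequence) is then determined.\<close>
lemma weak_conv_subsequence:
  fixes x :: "nat \<Rightarrow> 'a::banach"
  assumes uc: "uniformly_convex_space TYPE('a)" and bd: "bounded (range x)"
    and norming: "\<And>a::'a. \<exists>f::'a \<Rightarrow>\<^sub>L real. norm f \<le> 1 \<and> blinfun_apply f a = norm a"
  obtains s c where "strict_mono (s :: nat \<Rightarrow> nat)" "weak_conv (x \<circ> s) c"
proof -
  obtain D where D: "countable D" "span (range x) \<subseteq> closure D" by (rule span_range_separable)
  have "D \<noteq> {}" using D(2) span_zero by fastforce
  then have D_eq: "range (from_nat_into D) = D" using D(1) by simp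
  obtain g :: "'a \<Rightarrow> 'a \<Rightarrow>\<^sub>L real" where g: "\<And>a. norm (g a) \<le> 1" "\<And>a. blinfun_apply (g a) a = norm a"
    using norming by metis
  have fbd: "bounded (range (\<lambda>k. blinfun_apply f (x k)))" for f :: "'a \<Rightarrow>\<^sub>L real"
    using bounded_linear_image[OF bd blinfun.bounded_linear_right[of f]] by (simp add: image_image)
  obtain s where s: "strict_mono (s :: nat \<Rightarrow> nat)"
    and conv: "\<And>i. convergent (\<lambda>k. blinfun_apply (g (from_nat_into D i)) (x (s k)))"
    using bounded_diagonal_subsequence[of "\<lambda>i k. blinfun_apply (g (from_nat_into D i)) (x k)", OF fbd]
    by blast
  have conv: "convergent (\<lambda>k. blinfun_apply (g d) (x (s k)))" if "d \<in> D" for d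
    using conv that D_eq by (metis imageE)
  have center: "\<exists>c. \<forall>n. c \<in> closure (convex hull ((x \<circ> r) ` {n..}))" for r :: "nat \<Rightarrow> nat"
  proof -
    have "(\<Inter>n. closure (convex hull ((x \<circ> r) ` {n..}))) \<noteq> {}"
    proof (rule decseq_closed_convex_nonempty_Inter[OF uc])
      show "decseq (\<lambda>n. closure (convex hull ((x \<circ> r) ` {n..})))"
        unfolding decseq_def by (intro allI impI closure_mono hull_mono image_mono) auto
      show "bounded (closure (convex hull ((x \<circ> r) ` {0..})))"
        by (intro bounded_closure bounded_convex_hull bounded_subset[OF bd]) auto
    qed (auto intro: convex_closure)
    then show ?thesis by blast
  qed
  have in_span: "c \<in> closure (span (range x))" if "c \<in> closure (convex hull ((x \<circ> r) ` {n..}))" for c n and r :: "nat \<Rightarrow> nat"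
  proof -
    have "convex hull ((x \<circ> r) ` {n..}) \<subseteq> span (range x)"
      using convex_hull_subset_span span_mono[of "(x \<circ> r) ` {n..}" "range x"] by fastforce
    then show ?thesis using that closure_mono by blast
  qed
  obtain c where c: "\<And>n. c \<in> closure (convex hull ((x \<circ> s) ` {n..}))" using center[of s] by blast
  have "weak_conv (x \<circ> s) c"
    unfolding weak_conv_def
  proof (intro allI, rule ccontr)
    fix f :: "'a \<Rightarrow>\<^sub>L real" assume "\<not> (\<lambda>n. blinfun_apply f ((x \<circ> s) n)) \<longlonglongrightarrow> blinfun_apply f c"
    from not_tendsto_subsequence[OF this] obtain r e where r: "strict_mono (r :: nat \<Rightarrow> nat)" "0 < e"
        "\<And>n. e \<le> dist (blinfun_apply f ((x \<circ> s) (r n))) (blinfun_apply f c)"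
      by blast
    have "bounded (range (\<lambda>k. blinfun_apply f (x (s (r k)))))"
      by (rule bounded_subset[OF fbd[of f]]) auto
    then obtain l r' where r': "strict_mono (r' :: nat \<Rightarrow> nat)" "(\<lambda>k. blinfun_apply f (x (s (r (r' k))))) \<longlonglongrightarrow> l"
      using bounded_imp_convergent_subsequence[of "\<lambda>k. blinfun_apply f (x (s (r k)))"]
      by (auto simp: o_def)
    \<comment> \<open>Along this further subsequence \<open>f\<close> converges to \<open>l\<close>,
      and \<open>c'\<close> is a common tail point of it. Once \<open>c' = c\<close> is shown,
      \<open>l\<close> is the value of \<open>f\<close> at \<open>c\<close>, against the distance
      \<open>e\<close>.\<close>
    let ?s' = "s \<circ> (r \<circ> r')"
    have rr: "strict_mono (r \<circ> r')" using r r' by (simp add: strict_mono_o)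
    obtain c' where c': "\<And>n. c' \<in> closure (convex hull ((x \<circ> ?s') ` {n..}))" using center[of ?s'] by blast
    have g0: "blinfun_apply (g d) (c' - c) = 0" if d: "d \<in> D" for d
    proof -
      obtain m where m: "(\<lambda>k. blinfun_apply (g d) (x (s k))) \<longlonglongrightarrow> m"
        using conv[OF d] by (auto simp: convergent_def)
      have "blinfun_apply (g d) c = m"
        using c m by (intro closure_convex_hull_tail_limit[of c "x \<circ> s"]) (auto simp: o_def)
      moreover have "blinfun_apply (g d) c' = m"
        using c' LIMSEQ_subseq_LIMSEQ[OF m rr]
        by (intro closure_convex_hull_tail_limit[of c' "x \<circ> ?s'"]) (auto simp: o_def)
      ultimately show ?thesis by (simp add: blinfun.diff_right)
    qed
    have "c' - c \<in> closure (span (range x))"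
    proof -
      obtain a a' where "\<And>n. a n \<in> span (range x)" "a \<longlonglongrightarrow> c"
          "\<And>n. a' n \<in> span (range x)" "a' \<longlonglongrightarrow> c'"
        using in_span[OF c] in_span[OF c'] unfolding closure_sequential by blast
      then show ?thesis unfolding closure_sequential
        by (intro exI[of _ "\<lambda>n. a' n - a n"] conjI allI span_diff tendsto_diff)
    qed
    then have cD: "c' - c \<in> closure D" using closure_mono[OF D(2)] by auto
    \<comment> \<open>Close to \<open>c' - c\<close> lies some \<open>d\<close> in \<open>D\<close>
      whose norming functional kills \<open>c' - c\<close>. So \<open>d\<close> is itself no longer
      than the approximation error, and \<open>c' - c\<close> is small as well.\<close>
    have "norm (c' - c) \<le> 0 + \<epsilon>" if \<epsilon>: "0 < \<epsilon>" for \<epsilon>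
    proof -
      obtain d where d: "d \<in> D" "dist d (c' - c) < \<epsilon>/2"
        using cD \<epsilon> unfolding closure_approachable by (meson half_gt_zero)
      have "norm d = blinfun_apply (g d) (d - (c' - c))"
        using g(2) g0[OF d(1)] by (simp add: blinfun.diff_right)
      also have "\<dots> \<le> norm (g d) * norm (d - (c' - c))" using norm_blinfun[of "g d" "d - (c' - c)"] by simp
      also have "\<dots> \<le> norm (d - (c' - c))" using g(1) by (simp add: mult_left_le_one_le)
      finally have "norm d < \<epsilon>/2" using d(2) by (simp add: dist_norm)
      then show ?thesis using norm_triangle_sub[of "c' - c" d] d(2) by (simp add: dist_norm norm_minus_commute)
    qed
    then have "norm (c' - c) \<le> 0" by (rule field_le_epsilon)
    then have "(\<lambda>k. blinfun_apply f ((x \<circ> s) (r (r' k)))) \<longlonglongrightarrow> blinfun_apply f c"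
      using closure_convex_hull_tail_limit[OF c', of f l] r'(2) by (simp add: o_def)
    from tendsto_dist[OF this tendsto_const[of "blinfun_apply f c"]]
    have "e \<le> dist (blinfun_apply f c) (blinfun_apply f c)"
      by (rule LIMSEQ_le_const) (use r(3) in blast)
    with r(2) show False by simp
  qed
  with s show ?thesis by (rule that)
qed

text \<open>After division by the sum \<open>m\<close>, the weighted mean of \<open>u\<close> and
  \<open>v\<close> is 1. Taking logarithms, the hypothesis says that the weighted mean of
  \<open>ln u\<close> and \<open>ln v\<close> is nonnegative, while \<open>ln u \<le> u - 1\<close>
  and \<open>ln v \<le> v - 1\<close> bound it by 0; both are thus equalities, which forces
  \<open>u = v = 1\<close>.\<close>

lemma Youngs_inequality_equality_case:
  fixes a b p q :: real
  assumes p: "1 < p" and q: "q = p / (p - 1)" and ab: "0 \<le> a" "0 \<le> b"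
    and le: "a powr p / q + b powr p / p \<le> a powr (p - 1) * b"
  shows "a = b"
proof (cases "a = 0 \<or> b = 0")
  case True
  have "1 < q" using p by (simp add: q field_simps)
  then have "0 \<le> a powr p / q" "0 \<le> b powr p / p" using p by auto
  moreover have "a powr (p - 1) * b = 0" using True by auto
  ultimately have "a powr p / q = 0" "b powr p / p = 0" using le by linarith+
  then show ?thesis using \<open>1 < q\<close> p by auto
next
  case False
  then have pos: "0 < a" "0 < b" using ab by auto
  have q1: "1 < q" and pq: "1/q + 1/p = 1" "p / q = p - 1" using p by (auto simp: q field_simps)
  define m where "m = a powr p / q + b powr p / p"
  define u where "u = a powr p / m"
  define v where "v = b powr p / m"
  have m: "0 < m" using pos q1 p by (auto simp: m_def intro!: add_pos_pos)
  have uv: "0 < u" "0 < v" using m pos by (auto simp: u_def v_def)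
  have "u / q + v / p = (a powr p / q + b powr p / p) / m"
    by (simp add: u_def v_def add_divide_distrib mult.commute)
  then have sum1: "u / q + v / p = 1" using m by (simp flip: m_def)
  have lnu: "ln u = p * ln a - ln m" and lnv: "ln v = p * ln b - ln m"
    using m pos by (auto simp: u_def v_def ln_div ln_powr)
  have "ln m \<le> ln (a powr (p - 1) * b)" using le m pos by (simp add: m_def)
  also have "\<dots> = (p / q) * ln a + ln b" using pos by (simp add: ln_mult ln_powr pq)
  finally have "ln m \<le> (p / q) * ln a + ln b" .
  moreover have "ln u / q + ln v / p = (p / q) * ln a + ln b - (1/q + 1/p) * ln m"
    using p by (simp add: lnu lnv diff_divide_distrib distrib_right)
  ultimately have "0 \<le> ln u / q + ln v / p" by (simp add: pq)
  moreover have "(u - 1) / q + (v - 1) / p = 0"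
    using sum1 pq(1) by (simp add: diff_divide_distrib)
  moreover have "ln u / q \<le> (u - 1) / q" "ln v / p \<le> (v - 1) / p"
    using ln_le_minus_one uv q1 p by (auto intro!: divide_right_mono)
  ultimately have "ln u / q = (u - 1) / q" "ln v / p = (v - 1) / p" by linarith+
  then have "ln u = u - 1" "ln v = v - 1" using q1 p by auto
  then have "u = 1" "v = 1" using ln_eq_minus_one uv by auto
  then have "a powr p = b powr p" using m by (simp add: u_def v_def)
  then show ?thesis using pos p powr_less_mono2[of p a b] powr_less_mono2[of p b a] by linarith
qed

lemma powr_pred_mult: "0 \<le> a \<Longrightarrow> a powr (s - 1) * a = a powr s" for a s :: real
  by (cases "a = 0") (auto simp: powr_diff)

section \<open>Duality mappings and the Bregman distance\<close>

locale smooth_uniformly_convex =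
  fixes X :: "'a::banach itself" and p q :: real
  assumes p: "1 < p" and q_def: "q = p / (p - 1)"
    and smooth: "smooth_space TYPE('a)" and uconv: "uniformly_convex_space TYPE('a)"
begin

abbreviation J :: "'a \<Rightarrow> 'a \<Rightarrow>\<^sub>L real" where "J \<equiv> dual_map p"
abbreviation J' :: "('a \<Rightarrow>\<^sub>L real) \<Rightarrow> 'a" where "J' \<equiv> dual_map_dual q"
abbreviation D :: "'a \<Rightarrow> 'a \<Rightarrow> real" where "D \<equiv> bregman_dist p"

section \<open>The duality mappings \<open>J\<close> and \<open>J'\<close>\<close>

lemma q: "1 < q" and conjugate_exponents: "1/p + 1/q = 1" "(p - 1) * (q - 1) = 1"
  using p by (auto simp: q_def field_simps)

lemma norming_functional:
  fixes x :: 'a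
  obtains f :: "'a \<Rightarrow>\<^sub>L real" where "norm f \<le> 1" "blinfun_apply f x = norm x"
proof (cases "x = 0")
  case True
  then show ?thesis by (intro that[of 0]) auto
next
  case False
  then obtain f :: "'a \<Rightarrow>\<^sub>L real" where "norm f = 1" "blinfun_apply f x = norm x"
    using smooth unfolding smooth_space_def by blast
  then show ?thesis by (intro that) auto
qed

text \<open>Division by \<open>norm x powr (p - 1)\<close> turns every candidate into a norm-one
  functional with value \<open>norm x\<close> at \<open>x\<close>, and smoothness allows only one.
  At \<open>x = 0\<close> the convention \<open>0 powr a = 0\<close> makes every candidate
  vanish.\<close>

lemma J_eqI:
  fixes x :: 'a
  assumes g: "blinfun_apply g x = norm x powr p" "norm g = norm x powr (p - 1)"
  shows "J x = g"
  unfolding dual_map_def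
proof (rule the_equality)
  fix h :: "'a \<Rightarrow>\<^sub>L real" assume h: "blinfun_apply h x = norm x powr p \<and> norm h = norm x powr (p - 1)"
  show "h = g"
  proof (cases "x = 0")
    case True
    then show ?thesis using g h by simp
  next
    case False
    define c where "c = norm x powr (p - 1)"
    have c: "0 < c" "c * norm x = norm x powr p"
      using False powr_pred_mult[of "norm x" p] by (auto simp: c_def)
    have *: "norm (inverse c *\<^sub>R k) = 1 \<and> blinfun_apply (inverse c *\<^sub>R k) x = norm x"
      if k: "blinfun_apply k x = norm x powr p" "norm k = norm x powr (p - 1)" for k :: "'a \<Rightarrow>\<^sub>L real"
    proof
      show "norm (inverse c *\<^sub>R k) = 1" using c(1) k(2) by (simp add: c_def)
      have "blinfun_apply (inverse c *\<^sub>R k) x = inverse c * (c * norm x)"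
        by (simp only: blinfun.scaleR_left k(1) c(2) real_scaleR_def)
      then show "blinfun_apply (inverse c *\<^sub>R k) x = norm x" using c(1) by simp
    qed
    have "inverse c *\<^sub>R h = inverse c *\<^sub>R g"
      using smooth False *[of h] *[of g] g h unfolding smooth_space_def by blast
    then show ?thesis using c by simp
  qed
qed (use g in simp)

lemma J_apply: "blinfun_apply (J x) x = norm x powr p" and norm_J: "norm (J x) = norm x powr (p - 1)"
proof -
  have "\<exists>g::'a \<Rightarrow>\<^sub>L real. blinfun_apply g x = norm x powr p \<and> norm g = norm x powr (p - 1)"
  proof (cases "x = 0")
    case True
    then show ?thesis by (intro exI[of _ 0]) auto
  next
    case False
    then obtain f :: "'a \<Rightarrow>\<^sub>L real" where "norm f = 1" "blinfun_apply f x = norm x"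
      using smooth unfolding smooth_space_def by blast
    then show ?thesis
      by (intro exI[of _ "norm x powr (p - 1) *\<^sub>R f"]) (simp add: blinfun.scaleR_left powr_pred_mult)
  qed
  then show "blinfun_apply (J x) x = norm x powr p" "norm (J x) = norm x powr (p - 1)"
    using J_eqI by metis+
qed

lemma blinfun_apply_le: "blinfun_apply f x \<le> norm f * norm x" for f :: "'a \<Rightarrow>\<^sub>L real"
  using norm_blinfun[of f x] by simp

text \<open>Here uniqueness comes from uniform convexity: two candidates lie on one sphere, and
  \<open>f\<close> evaluated at their midpoint shows that the midpoint is not shorter than the
  radius.\<close>

lemma J'_eqI:
  fixes f :: "'a \<Rightarrow>\<^sub>L real"
  assumes x: "blinfun_apply f x = norm f powr q" "norm x = norm f powr (q - 1)"
  shows "J' f = x"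
  unfolding dual_map_dual_def
proof (rule the_equality)
  fix z :: 'a assume z: "blinfun_apply f z = norm f powr q \<and> norm z = norm f powr (q - 1)"
  have "norm (z - x) < e" if e: "0 < e" for e
  proof -
    obtain d where d: "0 < d" "\<And>a b::'a. norm a \<le> norm f powr (q - 1) + d \<Longrightarrow> norm b \<le> norm f powr (q - 1) + d \<Longrightarrow>
           norm f powr (q - 1) - d \<le> norm ((1/2) *\<^sub>R (a + b)) \<Longrightarrow> norm (a - b) < e"
      using uniformly_convex_near_sphere[OF uconv _ e, of "norm f powr (q - 1)"] by auto
    have "norm f powr (q - 1) \<le> norm ((1/2) *\<^sub>R (z + x))"
    proof (cases "f = 0")
      case False
      have "norm f * norm f powr (q - 1) = blinfun_apply f ((1/2) *\<^sub>R (z + x))"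
        using x z powr_pred_mult[of "norm f" q] by (simp add: blinfun.bilinear_simps mult.commute)
      also have "\<dots> \<le> norm f * norm ((1/2) *\<^sub>R (z + x))" by (rule blinfun_apply_le)
      finally show ?thesis using False by simp
    qed simp
    then show ?thesis using d(1) x z by (intro d(2)) auto
  qed
  then have "\<not> 0 < norm (z - x)" by blast
  then show "z = x" by simp
qed (use x in simp)

lemma J'_apply: "blinfun_apply f (J' f) = norm f powr q" and norm_J': "norm (J' f) = norm f powr (q - 1)"
proof -
  have "\<exists>x. blinfun_apply f x = norm f powr q \<and> norm x = norm f powr (q - 1)"
  proof (cases "f = 0")
    case True
    then show ?thesis by (intro exI[of _ 0]) auto
  next
    case False
    obtain x where x: "norm x \<le> 1" "blinfun_apply f x = norm f" using norm_attained[OF uconv] by blast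
    have "norm f * 1 \<le> norm f * norm x" using blinfun_apply_le[of f x] x by simp
    then have "norm x = 1" using False x by simp
    with x show ?thesis
      by (intro exI[of _ "norm f powr (q - 1) *\<^sub>R x"]) (simp add: blinfun.scaleR_right powr_pred_mult)
  qed
  then show "blinfun_apply f (J' f) = norm f powr q" "norm (J' f) = norm f powr (q - 1)"
    using J'_eqI by metis+
qed

lemma norm_J'_powr: "norm (J' f) powr p = norm f powr q"
proof -
  have "(q - 1) * p = q" using p by (simp add: q_def field_simps)
  then show ?thesis by (simp add: norm_J' powr_powr)
qed

text \<open>The functional \<open>f\<close> satisfies the two equations characterising
  \<open>J (J' f)\<close>, because \<open>(p - 1) * (q - 1) = 1\<close>. It lets \<open>J\<close>
  recover the updated functional from an iterate defined through \<open>J'\<close>.\<close>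

lemma J_J': "J (J' f) = f"
proof (rule J_eqI)
  show "blinfun_apply f (J' f) = norm (J' f) powr p" by (simp add: J'_apply norm_J'_powr)
  show "norm f = norm (J' f) powr (p - 1)"
    using conjugate_exponents(2) by (simp add: norm_J' powr_powr mult.commute)
qed

section \<open>Bregman distance: identities, convergence and boundedness\<close>

lemma D_eq: "D a b = norm a powr p / q - blinfun_apply (J a) b + norm b powr p / p"
  by (simp add: bregman_dist_def q_def)

lemma split_conj: "c / q + c / p = c" for c :: real
proof -
  have "c / q + c / p = c * (1/p + 1/q)" by (simp add: algebra_simps)
  then show ?thesis by (simp add: conjugate_exponents)
qed

text \<open>The two \<open>b\<close>-terms, weighted by \<open>1/p\<close> and \<open>1/q\<close>,
  add up to the pairing of \<open>J b\<close> with \<open>b\<close>. Orthogonality arguments below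
  consist in making the last term vanish.\<close>

lemma D_three_point: "D a c = D a b + D b c + blinfun_apply (J b - J a) (c - b)"
  using split_conj[of "norm b powr p"] J_apply[of b] by (simp add: D_eq blinfun.bilinear_simps)

lemma D_symmetric_sum: "D a b + D b a = blinfun_apply (J a - J b) (a - b)"
  using split_conj[of "norm a powr p"] split_conj[of "norm b powr p"] J_apply[of a] J_apply[of b]
  by (simp add: D_eq blinfun.bilinear_simps)

text \<open>A bound in terms of norms alone: it gives coercivity in the first argument and, in a
  limit with \<open>D\<close> tending to 0, the equality case of Young.\<close>

lemma D_ge: "norm a powr p / q + norm b powr p / p - norm a powr (p - 1) * norm b \<le> D a b"
  using blinfun_apply_le[of "J a" b] by (simp add: D_eq norm_J)

lemma functional_Young: "blinfun_apply f b \<le> norm f powr q / q + norm b powr p / p" for f :: "'a \<Rightarrow>\<^sub>L real"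
  using blinfun_apply_le[of f b] Youngs_inequality[OF q p _ norm_ge_zero norm_ge_zero, of f b] conjugate_exponents(1)
  by linarith

lemma norm_J_powr: "norm (J a) powr q = norm a powr p"
proof -
  have "(p - 1) * q = p" using p by (simp add: q_def)
  then show ?thesis by (simp add: norm_J powr_powr)
qed

lemma D_nonneg: "0 \<le> D a b"
  using functional_Young[of "J a" b] by (simp add: D_eq norm_J_powr)

text \<open>On a subsequence both norms converge, and the limit of \<open>D_ge\<close> forces equal
  limits by the equality case of Young. Pairing \<open>J (a n)\<close> with the midpoint then shows
  that midpoints are not short, and uniform convexity brings the sequences together.\<close>

lemma D_tendsto_0D:
  fixes a b :: "nat \<Rightarrow> 'a"
  assumes bd: "bounded (range a)" "bounded (range b)" and D: "(\<lambda>n. D (a n) (b n)) \<longlonglongrightarrow> 0"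
  shows "(\<lambda>n. a n - b n) \<longlonglongrightarrow> 0"
proof (rule ccontr)
  assume "\<not> (\<lambda>n. a n - b n) \<longlonglongrightarrow> 0"
  from not_tendsto_subsequence[OF this] obtain r e where
    r: "strict_mono (r :: nat \<Rightarrow> nat)" "0 < e" "\<And>n. e \<le> norm (a (r n) - b (r n))"
    by (auto simp: dist_norm)
  \<comment> \<open>Treating the two norms as one bounded sequence in the plane yields a single
    subsequence for both.\<close>
  have "bounded (norm ` range a \<times> norm ` range b)"
    using bd by (intro bounded_Times) (auto simp: bounded_iff)
  then have "bounded (range (\<lambda>n. (norm (a (r n)), norm (b (r n)))))" by (rule bounded_subset) auto
  from bounded_imp_convergent_subsequence[OF this] obtain l r' where
    r': "strict_mono (r' :: nat \<Rightarrow> nat)" "((\<lambda>n. (norm (a (r n)), norm (b (r n)))) \<circ> r') \<longlonglongrightarrow> l"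
    by blast
  define s where "s = r \<circ> r'"
  define \<alpha> where "\<alpha> = fst l"
  define \<beta> where "\<beta> = snd l"
  have s: "strict_mono s" unfolding s_def using r(1) r'(1) by (rule strict_mono_o)
  have lim: "(\<lambda>n. norm (a (s n))) \<longlonglongrightarrow> \<alpha>" "(\<lambda>n. norm (b (s n))) \<longlonglongrightarrow> \<beta>"
    using tendsto_fst[OF r'(2)] tendsto_snd[OF r'(2)] by (simp_all add: o_def s_def \<alpha>_def \<beta>_def)
  have nn: "0 \<le> \<alpha>" "0 \<le> \<beta>" using lim by (auto intro: LIMSEQ_le_const)
  have limD: "(\<lambda>n. D (a (s n)) (b (s n))) \<longlonglongrightarrow> 0"
    using LIMSEQ_subseq_LIMSEQ[OF D s] by (simp add: o_def)
  have lim_powr: "(\<lambda>n. norm (a (s n)) powr p) \<longlonglongrightarrow> \<alpha> powr p" "(\<lambda>n. norm (b (s n)) powr p) \<longlonglongrightarrow> \<beta> powr p"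
    "(\<lambda>n. norm (a (s n)) powr (p - 1)) \<longlonglongrightarrow> \<alpha> powr (p - 1)"
    using lim p by (auto intro!: tendsto_powr')
  have "\<alpha> powr p / q + \<beta> powr p / p - \<alpha> powr (p - 1) * \<beta> \<le> 0"
  proof (rule LIMSEQ_le[OF _ limD])
    show "(\<lambda>n. norm (a (s n)) powr p / q + norm (b (s n)) powr p / p - norm (a (s n)) powr (p - 1) * norm (b (s n)))
        \<longlonglongrightarrow> \<alpha> powr p / q + \<beta> powr p / p - \<alpha> powr (p - 1) * \<beta>"
      using p q by (intro tendsto_intros lim lim_powr) auto
  qed (use D_ge in blast)
  then have "\<beta> = \<alpha>"
    using Youngs_inequality_equality_case[OF p q_def nn] by simp
  obtain d where d: "0 < d" "\<And>a b::'a. norm a \<le> \<alpha> + d \<Longrightarrow> norm b \<le> \<alpha> + d \<Longrightarrow>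
           \<alpha> - d \<le> norm ((1/2) *\<^sub>R (a + b)) \<Longrightarrow> norm (a - b) < e"
    using uniformly_convex_near_sphere[OF uconv nn(1) r(2)] by blast
  have mid: "\<forall>\<^sub>F n in sequentially. \<alpha> - d \<le> norm ((1/2) *\<^sub>R (a (s n) + b (s n)))"
  proof (cases "\<alpha> = 0")
    case True
    with d(1) show ?thesis by (intro always_eventually) (auto intro: order_trans[OF _ norm_ge_zero])
  next
    case False
    then have \<alpha>: "0 < \<alpha> powr (p - 1)" using nn by simp
    let ?m = "\<lambda>n. norm ((1/2) *\<^sub>R (a (s n) + b (s n)))"
    \<comment> \<open>This is the value of \<open>J (a (s n))\<close> at the midpoint, with the
      pairing against \<open>b (s n)\<close> rewritten through \<open>D\<close>. Divided by the norm
      of \<open>J (a (s n))\<close> it bounds the midpoint norm from below and tends to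
      \<alpha>.\<close>
    let ?g = "\<lambda>n. (norm (a (s n)) powr p + (norm (a (s n)) powr p / q + norm (b (s n)) powr p / p - D (a (s n)) (b (s n)))) / 2"
    have g_le: "?g n \<le> norm (a (s n)) powr (p - 1) * ?m n" for n
      using blinfun_apply_le[of "J (a (s n))" "(1/2) *\<^sub>R (a (s n) + b (s n))"] J_apply[of "a (s n)"]
      by (simp add: D_eq norm_J blinfun.bilinear_simps)
    have "?g \<longlonglongrightarrow> (\<alpha> powr p + (\<alpha> powr p / q + \<beta> powr p / p - 0)) / 2"
      using p q by (intro tendsto_intros lim_powr limD) auto
    also have "(\<alpha> powr p + (\<alpha> powr p / q + \<beta> powr p / p - 0)) / 2 = \<alpha> powr (p - 1) * \<alpha>"
      using split_conj[of "\<alpha> powr p"] nn by (simp add: \<open>\<beta> = \<alpha>\<close> powr_pred_mult)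
    finally have "(\<lambda>n. ?g n / norm (a (s n)) powr (p - 1)) \<longlonglongrightarrow> \<alpha> powr (p - 1) * \<alpha> / \<alpha> powr (p - 1)"
      using \<alpha> by (intro tendsto_divide lim_powr) auto
    then have "(\<lambda>n. ?g n / norm (a (s n)) powr (p - 1)) \<longlonglongrightarrow> \<alpha>" using \<alpha> by simp
    then have "\<forall>\<^sub>F n in sequentially. \<alpha> - d < ?g n / norm (a (s n)) powr (p - 1)"
      using d(1) by (intro order_tendstoD(1)) auto
    moreover have "\<forall>\<^sub>F n in sequentially. 0 < norm (a (s n)) powr (p - 1)"
      using order_tendstoD(1)[OF lim_powr(3) \<alpha>] .
    ultimately show ?thesis
    proof eventually_elim
      case (elim n)
      then have "?g n / norm (a (s n)) powr (p - 1) \<le> ?m n"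
        using g_le[of n] by (simp add: pos_divide_le_eq mult.commute)
      with elim show ?case by linarith
    qed
  qed
  have "\<forall>\<^sub>F n in sequentially. norm (a (s n)) < \<alpha> + d" "\<forall>\<^sub>F n in sequentially. norm (b (s n)) < \<alpha> + d"
    using lim \<open>\<beta> = \<alpha>\<close> d(1) by (auto intro: order_tendstoD)
  with mid have "\<forall>\<^sub>F n in sequentially. norm (a (s n) - b (s n)) < e"
    by eventually_elim (auto intro: d(2))
  then obtain n where "norm (a (s n) - b (s n)) < e" by (auto simp: eventually_sequentially)
  with r(3)[of "r' n"] show False by (simp add: s_def)
qed

lemma D_eq_0D: "D a b = 0 \<Longrightarrow> a = b"
proof -
  assume "D a b = 0"
  then have "(\<lambda>_::nat. D a b) \<longlonglongrightarrow> 0" by simp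
  moreover have bd: "bounded (range (\<lambda>_::nat. z))" for z :: 'a by simp
  ultimately have "(\<lambda>_::nat. a - b) \<longlonglongrightarrow> 0" using D_tendsto_0D[OF bd bd] by blast
  then have "a - b = 0" by (rule LIMSEQ_unique[OF tendsto_const])
  then show "a = b" by simp
qed

text \<open>The distance from \<open>J' (F n)\<close> to \<open>J' f\<close> is at most its
  symmetrised version, which pairs \<open>F n - f\<close> with a bounded sequence of
  vectors.\<close>

lemma J'_tendsto:
  fixes F :: "nat \<Rightarrow> 'a \<Rightarrow>\<^sub>L real"
  assumes f: "F \<longlonglongrightarrow> f"
  shows "(\<lambda>n. J' (F n)) \<longlonglongrightarrow> J' f"
proof -
  have "(\<lambda>n. norm (J' (F n))) \<longlonglongrightarrow> norm f powr (q - 1)"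
    unfolding norm_J' using q by (intro tendsto_powr' tendsto_norm f tendsto_const) auto
  then have "bounded (range (\<lambda>n. norm (J' (F n))))" by (rule convergent_imp_bounded)
  then obtain B where B: "\<And>n. norm (J' (F n)) \<le> B" by (auto simp: bounded_iff)
  then have bd: "bounded (range (\<lambda>n. J' (F n)))" by (auto simp: bounded_iff)
  have "(\<lambda>n. norm (F n - f) * (B + norm (J' f))) \<longlonglongrightarrow> norm (f - f) * (B + norm (J' f))"
    by (intro tendsto_intros f)
  then have lim0: "(\<lambda>n. norm (F n - f) * (B + norm (J' f))) \<longlonglongrightarrow> 0" by simp
  have "D (J' (F n)) (J' f) \<le> norm (F n - f) * (B + norm (J' f))" for n
  proof -
    have "D (J' (F n)) (J' f) \<le> blinfun_apply (F n - f) (J' (F n) - J' f)"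
      using D_symmetric_sum[of "J' (F n)" "J' f"] D_nonneg[of "J' f" "J' (F n)"] by (simp add: J_J')
    also have "\<dots> \<le> norm (F n - f) * norm (J' (F n) - J' f)" by (rule blinfun_apply_le)
    also have "\<dots> \<le> norm (F n - f) * (B + norm (J' f))"
      using B[of n] norm_triangle_ineq4[of "J' (F n)" "J' f"] by (intro mult_left_mono) auto
    finally show ?thesis .
  qed
  then have "(\<lambda>n. D (J' (F n)) (J' f)) \<longlonglongrightarrow> 0"
    using D_nonneg by (intro tendsto_sandwich[OF always_eventually always_eventually tendsto_const lim0]) auto
  then have "(\<lambda>n. J' (F n) - J' f) \<longlonglongrightarrow> 0" using bd by (intro D_tendsto_0D) auto
  then show ?thesis by (simp add: LIM_zero_iff)
qed

text \<open>\<open>J'\<close> is the gradient of \<open>\<parallel>\<cdot>\<parallel>\<^sup>q / q\<close>; the subgradient inequality at \<open>f - \<tau> v\<close> together with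
  continuity of \<open>J'\<close> (let \<open>\<tau> \<rightarrow> 0\<close> from both sides) replaces the derivative.\<close>
lemma J'_first_order:
  fixes f v :: "'a \<Rightarrow>\<^sub>L real"
  assumes min: "\<And>\<tau>. norm f powr q / q \<le> norm (f - \<tau> *\<^sub>R v) powr q / q + \<tau> * \<beta>"
  shows "blinfun_apply v (J' f) = \<beta>"
proof -
  have *: "0 \<le> \<tau> * (\<beta> - blinfun_apply v (J' (f - \<tau> *\<^sub>R v)))" for \<tau>
  proof -
    let ?g = "f - \<tau> *\<^sub>R v"
    have "norm ?g powr q / q = blinfun_apply ?g (J' ?g) - norm (J' ?g) powr p / p"
      using split_conj[of "norm (J' ?g) powr p"] by (simp add: J'_apply norm_J'_powr)
    then have "norm ?g powr q / q \<le> norm f powr q / q - \<tau> * blinfun_apply v (J' ?g)"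
      using functional_Young[of f "J' ?g"] by (simp add: blinfun.bilinear_simps)
    with min[of \<tau>] show ?thesis by (simp add: algebra_simps)
  qed
  have lim: "(\<lambda>n. blinfun_apply v (J' (f - \<tau> n *\<^sub>R v))) \<longlonglongrightarrow> blinfun_apply v (J' f)" if "\<tau> \<longlonglongrightarrow> 0" for \<tau>
  proof -
    have "(\<lambda>n. f - \<tau> n *\<^sub>R v) \<longlonglongrightarrow> f - 0 *\<^sub>R v" by (intro tendsto_intros that)
    then show ?thesis by (intro blinfun.tendsto tendsto_const J'_tendsto) simp
  qed
  have "(\<lambda>n. - inverse (real (Suc n))) \<longlonglongrightarrow> 0" using tendsto_minus[OF LIMSEQ_inverse_real_of_nat] by simp
  from lim[OF this] have "\<beta> \<le> blinfun_apply v (J' f)"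
  proof (rule LIMSEQ_le_const, intro exI allI impI)
    fix n show "\<beta> \<le> blinfun_apply v (J' (f - (- inverse (real (Suc n))) *\<^sub>R v))"
      using *[of "- inverse (real (Suc n))"] by (simp add: mult_le_0_iff zero_le_mult_iff del: of_nat_Suc)
  qed
  moreover from lim[OF LIMSEQ_inverse_real_of_nat] have "blinfun_apply v (J' f) \<le> \<beta>"
  proof (rule LIMSEQ_le_const2, intro exI allI impI)
    fix n show "blinfun_apply v (J' (f - inverse (real (Suc n)) *\<^sub>R v)) \<le> \<beta>"
      using *[of "inverse (real (Suc n))"] by (simp add: zero_le_mult_iff del: of_nat_Suc)
  qed
  ultimately show ?thesis by simp
qed

text \<open>For a solution \<open>z\<close>, the difference \<open>z - c\<close> lies in the kernel,
  so the three-point identity loses its last term. Thus \<open>c\<close> is a minimizer, and any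
  other one has distance 0 from it; existence and uniqueness behind \<open>THE\<close> are settled
  together.\<close>

lemma bregman_proj_eqI:
  fixes A :: "'a \<Rightarrow>\<^sub>L 'b::real_normed_vector"
  assumes c: "blinfun_apply A c = y"
    and ann: "\<And>z. blinfun_apply A z = 0 \<Longrightarrow> blinfun_apply (J c) z = blinfun_apply (J a) z"
  shows "bregman_proj p {z. blinfun_apply A z = y} a = c"
proof -
  have D: "D a z = D a c + D c z" if "blinfun_apply A z = y" for z
    using D_three_point[of a z c] ann[of "z - c"] that c by (simp add: blinfun.bilinear_simps)
  show ?thesis
    unfolding bregman_proj_def
  proof (rule the_equality)
    show "c \<in> {z. blinfun_apply A z = y} \<and> (\<forall>z'\<in>{z. blinfun_apply A z = y}. D a c \<le> D a z')"
    proof (intro conjI ballI)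
      fix z assume "z \<in> {z. blinfun_apply A z = y}"
      then show "D a c \<le> D a z" using D[of z] D_nonneg[of c z] by simp
    qed (use c in simp)
    fix z assume z: "z \<in> {z. blinfun_apply A z = y} \<and> (\<forall>z'\<in>{z. blinfun_apply A z = y}. D a z \<le> D a z')"
    then have "blinfun_apply A z = y" "D a z \<le> D a c" using c by auto
    then have "D c z \<le> 0" using D[of z] by linarith
    then show "z = c" using D_nonneg[of c z] D_eq_0D[of c z] by simp
  qed
qed

lemma D_bounded_imp_bounded:
  assumes "\<And>n. D (a n) z \<le> B"
  shows "bounded (range a)"
proof -
  \<comment> \<open>Beyond the radius \<open>2 * q * norm z\<close>, the mixed term in
    \<open>D_ge\<close> consumes at most half of \<open>norm (a n) powr p / q\<close>; the other
    half is bounded by \<open>B\<close>.\<close>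
  have "norm (a n) \<le> max (2 * q * norm z) ((2 * q * B) powr (1 / p))" for n
  proof (cases "norm (a n) \<le> 2 * q * norm z")
    case False
    then have "norm z \<le> norm (a n) / (2 * q)" using q by (simp add: pos_le_divide_eq mult.commute)
    then have "norm (a n) powr (p - 1) * norm z \<le> norm (a n) powr (p - 1) * (norm (a n) / (2 * q))"
      by (intro mult_left_mono) auto
    also have "\<dots> = norm (a n) powr p / (2 * q)" using powr_pred_mult[of "norm (a n)" p] by simp
    finally have le: "norm (a n) powr (p - 1) * norm z \<le> norm (a n) powr p / (2 * q)" .
    have "0 \<le> norm z powr p / p" using p by simp
    then have "norm (a n) powr p / q - norm (a n) powr p / (2 * q) \<le> B"
      using le D_ge[of "a n" z] assms[of n] by linarith
    then have "norm (a n) powr p \<le> 2 * q * B" using q by (simp add: field_simps)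
    then have "(norm (a n) powr p) powr (1 / p) \<le> (2 * q * B) powr (1 / p)" using p by (intro powr_mono2) auto
    then show ?thesis using p by (simp add: powr_powr)
  qed simp
  then show ?thesis unfolding bounded_iff by blast
qed

end

section \<open>The SESOP iteration\<close>

text \<open>Used to vary one coefficient of \<open>t n\<close>; the generality over real vector
  spaces covers both the sum of directions and the real sum of offsets.\<close>

lemma sum_scaleR_add_single:
  fixes g :: "'i \<Rightarrow> 'v::real_vector"
  assumes "finite I" "k \<in> I"
  shows "(\<Sum>i\<in>I. (c i + (if i = k then \<tau> else 0)) *\<^sub>R g i) = (\<Sum>i\<in>I. c i *\<^sub>R g i) + \<tau> *\<^sub>R g k"
proof -
  have "(\<Sum>i\<in>I. (if i = k then \<tau> else 0) *\<^sub>R g i) = (\<Sum>i\<in>I. if i = k then \<tau> *\<^sub>R g i else 0)"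
    by (rule sum.cong) auto
  then show ?thesis using assms by (simp add: scaleR_left_distrib sum.distrib)
qed

theorem mainTheorem1:
  fixes p r :: real and N :: nat
    and A :: "'a::banach \<Rightarrow>\<^sub>L 'b::banach" and y :: 'b
    and JrY :: "'b \<Rightarrow> ('b \<Rightarrow>\<^sub>L real)"
    and x :: "nat \<Rightarrow> 'a"
    and s t :: "nat \<Rightarrow> nat \<Rightarrow> real"
    and v :: "nat \<Rightarrow> nat \<Rightarrow> ('a \<Rightarrow>\<^sub>L real)"
    and w :: "nat \<Rightarrow> nat \<Rightarrow> ('b \<Rightarrow>\<^sub>L real)"
  assumes p: "1 < p" and r: "1 < r"
    and smooth: "smooth_space TYPE('a)"
    and uconv: "uniformly_convex_space TYPE('a)"
    and Jweak: "\<forall>xs xx. weak_conv (xs :: nat \<Rightarrow> 'a) xx \<longrightarrow>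
                   weak_conv (\<lambda>n. dual_map p (xs n)) (dual_map p xx)"
    and JrY: "\<forall>z. blinfun_apply (JrY z) z = norm z powr r \<and> norm (JrY z) = norm z powr (r - 1)"
    and y: "y \<in> range (blinfun_apply A)"
    and N: "1 \<le> N"
    and x0: "dual_map p (x 0) \<in> closure (range (\<lambda>u::'b \<Rightarrow>\<^sub>L real. u o\<^sub>L A))"
    and step: "\<And>n. (\<forall>k\<le>n. blinfun_apply A (x k) \<noteq> y) \<Longrightarrow>
      (let wres = blinfun_apply A (x n) - y;
           ustar = JrY wres;
           u = ustar o\<^sub>L A;
           Nold = min N n;
           Nn = min N (Suc n);
           q = p / (p - 1)
       in (\<forall>s'. norm (u - (\<Sum>i=1..Nold. s n i *\<^sub>R v (n - 1) i)) powr q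
                   \<le> norm (u - (\<Sum>i=1..Nold. s' i *\<^sub>R v (n - 1) i)) powr q)
        \<and> v n Nn = u - (\<Sum>i=1..Nold. s n i *\<^sub>R v (n - 1) i)
        \<and> w n Nn = ustar - (\<Sum>i=1..Nold. s n i *\<^sub>R w (n - 1) i)
        \<and> (\<forall>k. 1 \<le> k \<and> k < Nn \<longrightarrow>
              v n k = v (n - 1) (k + Nold + 1 - Nn) \<and> w n k = w (n - 1) (k + Nold + 1 - Nn))
        \<and> (\<forall>t'. norm (dual_map p (x n) - (\<Sum>k=1..Nn. t n k *\<^sub>R v n k)) powr q / q
                    + (\<Sum>k=1..Nn. t n k * blinfun_apply (w n k) y)
                 \<le> norm (dual_map p (x n) - (\<Sum>k=1..Nn. t' k *\<^sub>R v n k)) powr q / q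
                    + (\<Sum>k=1..Nn. t' k * blinfun_apply (w n k) y))
        \<and> x (Suc n) = dual_map_dual q (dual_map p (x n) - (\<Sum>k=1..Nn. t n k *\<^sub>R v n k)))"
  shows "(\<exists>n. (\<forall>k<n. blinfun_apply A (x k) \<noteq> y) \<and> blinfun_apply A (x n) = y
             \<and> x n = bregman_proj p {z. blinfun_apply A z = y} (x 0))
       \<or> ((\<forall>n. blinfun_apply A (x n) \<noteq> y)
             \<and> weak_conv x (bregman_proj p {z. blinfun_apply A z = y} (x 0)))"
proof -
  define q where "q = p / (p - 1)"
  interpret smooth_uniformly_convex "TYPE('a)" p q
    using p smooth uconv by unfold_locales (auto simp: q_def)
  define I where "I n = {1..min N (Suc n)}" for n
  \<comment> \<open>\<open>M n\<close> is the slot of the newest direction. The preceding list has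
    \<open>min N n\<close> slots, hence none for \<open>n = 0\<close>.\<close>
  define M where "M n = min N (Suc n)" for n
  define running where "running n \<longleftrightarrow> (\<forall>k\<le>n. blinfun_apply A (x k) \<noteq> y)" for n
  define W where "W n = blinfun_apply A (x n) - y" for n
  define P where "P = bregman_proj p {z. blinfun_apply A z = y} (x 0)"
  have runningD: "running k" if "running n" "k \<le> n" for k n
    using that by (auto simp: running_def)
  have MI: "M n \<in> I n" for n using N by (simp add: M_def I_def)
  note S = step[unfolded Let_def, folded q_def running_def W_def M_def]
  \<comment> \<open>The competitor with all coefficients 0 shows that orthogonalisation does not
    lengthen the Landweber direction.\<close>
  have s_min: "norm (v n (M n)) powr q \<le> norm (JrY (W n) o\<^sub>L A) powr q" if "running n" for n
    using S[OF that, THEN conjunct1, rule_format, of "\<lambda>_. 0"] S[OF that] by simp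
  have v_new: "v n (M n) = (JrY (W n) o\<^sub>L A) - (\<Sum>i=1..min N n. s n i *\<^sub>R v (n - 1) i)" if "running n" for n
    using S[OF that] by blast
  have w_new: "w n (M n) = JrY (W n) - (\<Sum>i=1..min N n. s n i *\<^sub>R w (n - 1) i)" if "running n" for n
    using S[OF that] by blast
  \<comment> \<open>While the list still grows, the old slot is \<open>k\<close> itself; once it is
    full, the slot is \<open>k + 1\<close> and the oldest direction drops out. For
    \<open>n = 0\<close> the only slot is the new one.\<close>
  have vw_old: "\<exists>i\<in>I (n - 1). 0 < n \<and> v n k = v (n - 1) i \<and> w n k = w (n - 1) i"
    if "running n" "k \<in> I n" "k \<noteq> M n" for n k
  proof -
    have k: "1 \<le> k \<and> k < M n" using that(2,3) by (auto simp: I_def M_def)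
    then have "k + min N n + 1 - M n \<in> I (n - 1)" "0 < n" by (auto simp: I_def M_def)
    with k S[OF that(1)] show ?thesis by blast
  qed
  have t_min: "norm (J (x n) - (\<Sum>k\<in>I n. t n k *\<^sub>R v n k)) powr q / q + (\<Sum>k\<in>I n. t n k * blinfun_apply (w n k) y)
      \<le> norm (J (x n) - (\<Sum>k\<in>I n. t' k *\<^sub>R v n k)) powr q / q + (\<Sum>k\<in>I n. t' k * blinfun_apply (w n k) y)"
    if "running n" for n t'
    using S[OF that] unfolding I_def M_def by blast
  have x_Suc: "x (Suc n) = J' (J (x n) - (\<Sum>k\<in>I n. t n k *\<^sub>R v n k))" if "running n" for n
    using S[OF that] unfolding I_def M_def by blast
  have J_x_Suc: "J (x (Suc n)) = J (x n) - (\<Sum>k\<in>I n. t n k *\<^sub>R v n k)" if "running n" for n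
    using x_Suc[OF that] J_J' by simp
  have old_I: "i \<in> I (n - 1)" "0 < n" if "i \<in> {1..min N n}" for i n
    using that by (auto simp: I_def)

  \<comment> \<open>Consequences of a single step\<close>
  have vw: "blinfun_apply (v n k) z = blinfun_apply (w n k) (blinfun_apply A z)"
    if "running n" "k \<in> I n" for n k z
    using that
  proof (induction n arbitrary: k)
    case (0 k)
    then have "k = M 0" using N by (auto simp: I_def M_def)
    then show ?case by (simp add: v_new[OF 0(1)] w_new[OF 0(1)])
  next
    case (Suc n k)
    have run: "running n" using runningD[OF Suc.prems(1)] by simp
    show ?case
    proof (cases "k = M (Suc n)")
      case True
      have "blinfun_apply (v n i) z = blinfun_apply (w n i) (blinfun_apply A z)" if "i \<in> {1..min N (Suc n)}" for i
        using Suc.IH[OF run] that by (simp add: I_def)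
      then show ?thesis
        by (simp add: True v_new[OF Suc.prems(1)] w_new[OF Suc.prems(1)] blinfun.bilinear_simps blinfun.sum_left)
    next
      case False
      then show ?thesis using vw_old[OF Suc.prems] Suc.IH[OF run] by auto
    qed
  qed

  \<comment> \<open>Moving only the coefficient of \<open>v n k\<close> turns minimality of
    \<open>t n\<close> into the one-dimensional condition of \<open>J'_first_order\<close>, with the
    offset as slope.\<close>
  have on_hyperplane: "blinfun_apply (v n k) (x (Suc n)) = blinfun_apply (w n k) y"
    if run: "running n" and k: "k \<in> I n" for n k
    unfolding x_Suc[OF run]
  proof (rule J'_first_order)
    fix \<tau>
    have fin: "finite (I n)" by (simp add: I_def)
    show "norm (J (x n) - (\<Sum>k\<in>I n. t n k *\<^sub>R v n k)) powr q / q
        \<le> norm (J (x n) - (\<Sum>k\<in>I n. t n k *\<^sub>R v n k) - \<tau> *\<^sub>R v n k) powr q / q + \<tau> * blinfun_apply (w n k) y"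
      using t_min[OF run, of "\<lambda>i. t n i + (if i = k then \<tau> else 0)"]
        sum_scaleR_add_single[OF fin k, of "t n" \<tau> "v n"]
        sum_scaleR_add_single[OF fin k, of "t n" \<tau> "\<lambda>i. blinfun_apply (w n i) y"]
      by (simp add: diff_diff_eq)
  qed

  have residual: "norm (W n) \<le> norm A * norm (x n - x (Suc n))" if run: "running n" for n
  proof -
    have pos: "0 < norm (W n)" using run by (simp add: running_def W_def)
    \<comment> \<open>The current iterate lies on all hyperplanes of the previous step, so old
      precursors annihilate the residual and the orthogonalising correction does not change the
      pairing with it.\<close>
    have old0: "blinfun_apply (w (n - 1) i) (W n) = 0" if i: "i \<in> {1..min N n}" for i
    proof -
      obtain m where m: "n = Suc m" using old_I(2)[OF i] gr0_implies_Suc by blast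
      have "running m" using runningD[OF run] m by simp
      then show ?thesis using on_hyperplane[of m i] vw[of m i] old_I(1)[OF i] m
        by (simp add: W_def blinfun.diff_right)
    qed
    have "norm (W n) powr (r - 1) * norm (W n) = norm (W n) powr r" by (rule powr_pred_mult) simp
    also have "\<dots> = blinfun_apply (JrY (W n)) (W n)" using JrY by simp
    also have "\<dots> = blinfun_apply (w n (M n)) (W n)"
      using old0 by (simp add: w_new[OF run] blinfun.bilinear_simps blinfun.sum_left)
    \<comment> \<open>\<open>v n (M n)\<close> factors through \<open>A\<close>, and its value at
      the next iterate is the offset, that is, the precursor applied to \<open>y\<close>.\<close>
    also have "\<dots> = blinfun_apply (v n (M n)) (x n - x (Suc n))"
      using vw[OF run MI] on_hyperplane[OF run MI] by (simp add: W_def blinfun.diff_right)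
    also have "\<dots> \<le> norm (v n (M n)) * norm (x n - x (Suc n))" by (rule blinfun_apply_le)
    also have "\<dots> \<le> norm (W n) powr (r - 1) * norm A * norm (x n - x (Suc n))"
    proof (rule mult_right_mono)
      have "norm (v n (M n)) \<le> norm (JrY (W n) o\<^sub>L A)"
        using s_min[OF run] q by (meson less_le_not_le not_le norm_ge_zero order_less_trans powr_less_mono2 zero_less_one)
      also have "\<dots> \<le> norm (JrY (W n)) * norm A" by (rule norm_blinfun_compose)
      finally show "norm (v n (M n)) \<le> norm (W n) powr (r - 1) * norm A" using JrY by simp
    qed simp
    finally show ?thesis using pos by (simp add: mult.assoc)
  qed

  \<comment> \<open>Each update of \<open>J (x n)\<close> is a combination of directions that factor
    through \<open>A\<close>, so its values on the kernel never change.\<close>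
  have annihilates: "blinfun_apply (J (x n)) z = blinfun_apply (J (x 0)) z"
    if "\<forall>k<n. blinfun_apply A (x k) \<noteq> y" "blinfun_apply A z = 0" for n z
    using that(1)
  proof (induction n)
    case (Suc n)
    then have run: "running n" by (simp add: running_def less_Suc_eq_le)
    show ?case using Suc vw[OF run] that(2)
      by (simp add: J_x_Suc[OF run] blinfun.bilinear_simps blinfun.sum_left)
  qed simp

  \<comment> \<open>Finite termination or weak convergence\<close>
  show ?thesis
  proof (cases "\<exists>n. blinfun_apply A (x n) = y")
    case True
    then obtain n where n: "blinfun_apply A (x n) = y" "\<forall>k<n. blinfun_apply A (x k) \<noteq> y"
      using exists_least_iff[of "\<lambda>n. blinfun_apply A (x n) = y"] by blast
    have "P = x n" unfolding P_def
    proof (rule bregman_proj_eqI[OF n(1)])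
      fix z assume "blinfun_apply A z = 0"
      with annihilates[OF n(2)] show "blinfun_apply (J (x n)) z = blinfun_apply (J (x 0)) z" .
    qed
    with n show ?thesis unfolding P_def by metis
  next
    case False
    then have run: "running n" for n by (simp add: running_def)
    obtain z where z: "blinfun_apply A z = y" using y by auto
    have pythagoras: "D (x n) (x (Suc n)) = D (x n) z - D (x (Suc n)) z" for n
    proof -
      \<comment> \<open>The update is a combination of the \<open>v n k\<close>, each of which takes
        its offset as value both at the solution \<open>z\<close> and at
        \<open>x (Suc n)\<close>.\<close>
      have "blinfun_apply (J (x (Suc n)) - J (x n)) (z - x (Suc n)) = 0"
        using vw[OF run] on_hyperplane[OF run] z
        by (simp add: J_x_Suc[OF run] blinfun.bilinear_simps blinfun.sum_left)
      then show ?thesis using D_three_point[of "x n" z "x (Suc n)"] by simp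
    qed
    have dec: "decseq (\<lambda>n. D (x n) z)"
    proof (rule decseq_SucI)
      fix n show "D (x (Suc n)) z \<le> D (x n) z"
        using pythagoras[of n] D_nonneg[of "x n" "x (Suc n)"] by linarith
    qed
    then obtain L where L: "(\<lambda>n. D (x n) z) \<longlonglongrightarrow> L" using decseq_convergent[OF dec, of 0] D_nonneg by blast
    have bd: "bounded (range x)"
      using decseqD[OF dec, of 0] by (intro D_bounded_imp_bounded[of x z "D (x 0) z"]) simp
    have "(\<lambda>n. D (x n) z - D (x (Suc n)) z) \<longlonglongrightarrow> L - L" by (intro tendsto_diff L LIMSEQ_Suc)
    then have D0: "(\<lambda>n. D (x n) (x (Suc n))) \<longlonglongrightarrow> 0" by (simp add: pythagoras)
    have "bounded (range (\<lambda>n. x (Suc n)))" by (rule bounded_subset[OF bd]) auto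
    from D_tendsto_0D[OF bd this D0] have "(\<lambda>n. norm A * norm (x n - x (Suc n))) \<longlonglongrightarrow> norm A * norm (0::'a)"
      by (intro tendsto_intros)
    then have "(\<lambda>n. norm A * norm (x n - x (Suc n))) \<longlonglongrightarrow> 0" by simp
    then have "W \<longlonglongrightarrow> 0"
      using residual[OF run] by (intro Lim_null_comparison[of W]) auto
    then have Ax: "(\<lambda>n. blinfun_apply A (x n)) \<longlonglongrightarrow> y" unfolding W_def by (rule LIM_zero_cancel)

    have cluster: "c = P" if s': "strict_mono s'" and c: "weak_conv (x \<circ> s') c" for s' c
    proof -
      \<comment> \<open>This functional pairs with the residual of \<open>c\<close> to
        \<open>norm (blinfun_apply A c - y) powr r\<close>. Its values along the subsequence have
        both the weak limit at \<open>blinfun_apply A c\<close> and the strong limit at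
        \<open>y\<close>, so the residual is 0.\<close>
      let ?g = "JrY (blinfun_apply A c - y)"
      have "(\<lambda>n. blinfun_apply ?g (blinfun_apply A (x (s' n)))) \<longlonglongrightarrow> blinfun_apply ?g (blinfun_apply A c)"
        using c[unfolded weak_conv_def, rule_format, of "?g o\<^sub>L A"] by simp
      moreover have "(\<lambda>n. blinfun_apply ?g (blinfun_apply A (x (s' n)))) \<longlonglongrightarrow> blinfun_apply ?g y"
        using LIMSEQ_subseq_LIMSEQ[OF Ax s'] by (intro blinfun.tendsto tendsto_const) (simp add: o_def)
      ultimately have "blinfun_apply ?g (blinfun_apply A c) = blinfun_apply ?g y" by (rule LIMSEQ_unique)
      then have "norm (blinfun_apply A c - y) powr r = 0"
        using JrY[rule_format, of "blinfun_apply A c - y"] by (simp add: blinfun.diff_right)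
      then have Ac: "blinfun_apply A c = y" by simp
      have "blinfun_apply (J c) u = blinfun_apply (J (x 0)) u" if u: "blinfun_apply A u = 0" for u
      proof -
        \<comment> \<open>Weak convergence in the dual is tested by functionals on the dual;
          evaluation at \<open>u\<close> is the one needed here.\<close>
        define E where "E = Blinfun (\<lambda>f :: 'a \<Rightarrow>\<^sub>L real. blinfun_apply f u)"
        have E: "blinfun_apply E f = blinfun_apply f u" for f
          unfolding E_def by (simp add: bounded_linear_Blinfun_apply blinfun.bounded_linear_left)
        have "weak_conv (\<lambda>n. J ((x \<circ> s') n)) (J c)" using Jweak c by blast
        then have "(\<lambda>n. blinfun_apply (J (x (s' n))) u) \<longlonglongrightarrow> blinfun_apply (J c) u"
          unfolding weak_conv_def by (auto dest: spec[of _ E] simp: E)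
        moreover have "blinfun_apply (J (x (s' n))) u = blinfun_apply (J (x 0)) u" for n
          using annihilates u False by blast
        ultimately show ?thesis using LIMSEQ_unique[OF _ tendsto_const] by simp
      qed
      then show ?thesis unfolding P_def using Ac by (intro bregman_proj_eqI[symmetric]) auto
    qed

    have "weak_conv x P"
      unfolding weak_conv_def
    proof (intro allI, rule ccontr)
      fix f :: "'a \<Rightarrow>\<^sub>L real" assume "\<not> (\<lambda>n. blinfun_apply f (x n)) \<longlonglongrightarrow> blinfun_apply f P"
      from not_tendsto_subsequence[OF this] obtain \<sigma> e where
        \<sigma>: "strict_mono (\<sigma> :: nat \<Rightarrow> nat)" "0 < e" "\<And>n. e \<le> dist (blinfun_apply f (x (\<sigma> n))) (blinfun_apply f P)"
        by blast
      have "bounded (range (x \<circ> \<sigma>))" by (rule bounded_subset[OF bd]) auto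
      moreover have "\<exists>f :: 'a \<Rightarrow>\<^sub>L real. norm f \<le> 1 \<and> blinfun_apply f a = norm a" for a :: 'a
        using norming_functional[of a] by blast
      ultimately obtain \<rho> c where \<rho>: "strict_mono (\<rho> :: nat \<Rightarrow> nat)" and c: "weak_conv ((x \<circ> \<sigma>) \<circ> \<rho>) c"
        using weak_conv_subsequence[OF uconv] by blast
      \<comment> \<open>The extracted weak limit is also a cluster point of the full sequence, so it
        must be \<open>P\<close>, although \<open>f\<close> stays \<open>e\<close> away from its
        value at \<open>P\<close>.\<close>
      have "c = P" using cluster[OF strict_mono_o[OF \<sigma>(1) \<rho>]] c by (simp add: comp_assoc)
      with c have "(\<lambda>n. blinfun_apply f (x (\<sigma> (\<rho> n)))) \<longlonglongrightarrow> blinfun_apply f P"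
        by (simp add: weak_conv_def)
      from tendsto_dist[OF this tendsto_const[of "blinfun_apply f P"]]
      have "e \<le> dist (blinfun_apply f P) (blinfun_apply f P)"
        by (rule LIMSEQ_le_const) (use \<sigma>(3) in blast)
      with \<sigma>(2) show False by simp
    qed
    with False show ?thesis unfolding P_def by blast
  qed
qed

end
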